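(* Let the timestep $k>0$ be constant and let $a,b,c\in\mathbb{R}$ with $a\neq -1$. Consider, for the initial value problem $y'(t)=f(t,y(t))$, the combination of backward Euler and a general 3-point time filter $$\text{Step 1: } \frac{y_{n+1}^{\ast}-y_n}{k}=f(t_{n+1},y_{n+1}^{\ast}),\qquad \text{Step 2: } y_{n+1}=y_{n+1}^{\ast}+\{a\,y_{n+1}^{\ast}+b\,y_n+c\,y_{n-1}\}.$$ This combination is consistent if and only if there is some $\nu\neq 2$ with $$a=-\frac{\nu}{2},\qquad c=-\frac{\nu}{2},\qquad b=\nu,$$ so that the filter is $$y_{n+1}=y_{n+1}^{\ast}-\frac{\nu}{2}\left(y_{n+1}^{\ast}-2y_n+y_{n-1}\right).$$ In this case the equivalent 2-step method for the post-filtered values is $$\frac{1}{1-\frac{\nu}{2}}y_{n+1}-\frac{1+\frac{\nu}{2}}{1-\frac{\nu}{2}}y_n+\frac{\frac{\nu}{2}}{1-\frac{\nu}{2}}y_{n-1}=k f\!\left(t_{n+1},\ \frac{1}{1-\frac{\nu}{2}}y_{n+1}-\frac{\nu}{1-\frac{\nu}{2}}y_n+\frac{\frac{\nu}{2}}{1-\frac{\nu}{2}}y_{n-1}\right),$$ and the combination is second order accurate if and only if $\nu=\frac{2}{3}$.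
   Context: Here $t_{n+1}=t_n+k$, and $y_{n+1}^{\ast}$ is the pre-filtered value. Eliminating $y_{n+1}^{\ast}$ between Steps 1 and 2 (solving Step 2 for $y_{n+1}^{\ast}$ and substituting in Step 1) gives the equivalent 2-step method for the post-filtered values, which has the one-leg form $$\alpha_2y_{n+1}+\alpha_1y_n+\alpha_0y_{n-1}=k f(t_{n+1},\beta_2y_{n+1}+\beta_1y_n+\beta_0y_{n-1}).$$ Consistency and order of the combination mean those of this 2-step method. The local truncation error (LTE) of such a method is $$\mathrm{LTE}=\sum_{j=0}^{2}\alpha_j\,y(t_{n-1+j})-k\sum_{j=0}^{2}\beta_j\,y'(t_{n-1+j}),$$ with Taylor expansion for smooth $y$ $$\mathrm{LTE}=[\alpha_2+\alpha_1+\alpha_0]\,y(t_n)+k[\alpha_2-\alpha_0-(\beta_2+\beta_1+\beta_0)]\,y'(t_n)+k^2\left[\tfrac{\alpha_2}{2}+\tfrac{\alpha_0}{2}-\beta_2+\beta_0\right]y''(t_n)+\mathcal{O}(k^3).$$ The method is called consistent if the first two bracketed coefficients (those of $y(t_n)$ and $k y'(t_n)$) are zero, and a consistent method is called second order accurate if the third bracketed coefficient (that of $k^2y''(t_n)$) is zero as well. *)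

theory Defs
  imports "HOL-Analysis.Analysis"
begin

text \<open>
  Throughout, \<open>t\<close> is \<open>t\<^sub>n\<close>, \<open>k\<close> is the timestep, and \<open>ym\<close>, \<open>y\<close>, \<open>yp\<close>, \<open>ys\<close> stand for
  \<open>y\<^sub>n\<^sub>-\<^sub>1\<close>, \<open>y\<^sub>n\<close>, \<open>y\<^sub>n\<^sub>+\<^sub>1\<close> and the pre-filtered value \<open>y\<^sub>n\<^sub>+\<^sub>1\<^sup>*\<close>. Solutions take values in an arbitrary
  Euclidean space, so scalar equations and systems are both covered.
\<close>

definition backward_euler_step ::
    "real \<Rightarrow> (real \<Rightarrow> 'a::real_normed_vector \<Rightarrow> 'a) \<Rightarrow> real \<Rightarrow> 'a \<Rightarrow> 'a \<Rightarrow> bool" where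
  "backward_euler_step k f t y ys \<longleftrightarrow> (ys - y) /\<^sub>R k = f (t + k) ys"

definition time_filter :: "real \<Rightarrow> real \<Rightarrow> real \<Rightarrow> 'a::real_normed_vector \<Rightarrow> 'a \<Rightarrow> 'a \<Rightarrow> 'a" where
  "time_filter a b c ys y ym = ys + (a *\<^sub>R ys + b *\<^sub>R y + c *\<^sub>R ym)"

text \<open>
  The implicit equation of Step 1 need not be uniquely solvable, so a step is a relation between the
  old and the new post-filtered values.
\<close>

definition filtered_step ::
    "real \<Rightarrow> real \<Rightarrow> real \<Rightarrow> real \<Rightarrow> (real \<Rightarrow> 'a::real_normed_vector \<Rightarrow> 'a) \<Rightarrow> real
      \<Rightarrow> 'a \<Rightarrow> 'a \<Rightarrow> 'a \<Rightarrow> bool" where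
  "filtered_step k a b c f t ym y yp \<longleftrightarrow>
     (\<exists>ys. backward_euler_step k f t y ys \<and> yp = time_filter a b c ys y ym)"

record two_step_method =
  alpha2 :: real
  alpha1 :: real
  alpha0 :: real
  beta2 :: real
  beta1 :: real
  beta0 :: real

definition one_leg_step ::
    "two_step_method \<Rightarrow> real \<Rightarrow> (real \<Rightarrow> 'a::real_normed_vector \<Rightarrow> 'a) \<Rightarrow> real
      \<Rightarrow> 'a \<Rightarrow> 'a \<Rightarrow> 'a \<Rightarrow> bool" where
  "one_leg_step M k f t ym y yp \<longleftrightarrow>
     alpha2 M *\<^sub>R yp + alpha1 M *\<^sub>R y + alpha0 M *\<^sub>R ym =
     k *\<^sub>R f (t + k) (beta2 M *\<^sub>R yp + beta1 M *\<^sub>R y + beta0 M *\<^sub>R ym)"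

text \<open>
  The factor \<open>[\<alpha>\<^sub>2 + \<alpha>\<^sub>1 + \<alpha>\<^sub>0]\<close> of \<open>y(t\<^sub>n)\<close>, and the factors of \<open>k y'(t\<^sub>n)\<close> and \<open>k\<^sup>2 y''(t\<^sub>n)\<close>, in the Taylor
  expansion of the local truncation error; see \<open>local_truncation_error_expansion\<close> below.
\<close>

definition lte_coeff0 :: "two_step_method \<Rightarrow> real" where
  "lte_coeff0 M = alpha2 M + alpha1 M + alpha0 M"

definition lte_coeff1 :: "two_step_method \<Rightarrow> real" where
  "lte_coeff1 M = alpha2 M - alpha0 M - (beta2 M + beta1 M + beta0 M)"

definition lte_coeff2 :: "two_step_method \<Rightarrow> real" where
  "lte_coeff2 M = alpha2 M / 2 + alpha0 M / 2 - beta2 M + beta0 M"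

definition consistent_method :: "two_step_method \<Rightarrow> bool" where
  "consistent_method M \<longleftrightarrow> lte_coeff0 M = 0 \<and> lte_coeff1 M = 0"

definition second_order_method :: "two_step_method \<Rightarrow> bool" where
  "second_order_method M \<longleftrightarrow> consistent_method M \<and> lte_coeff2 M = 0"

text \<open>
  Equivalence is required for every right-hand side \<open>f\<close>. This determines the coefficients, including
  their scaling, uniquely (\<open>equivalent_method_iff\<close> below), so the existential quantifiers in
  \<open>consistent_combination\<close> and \<open>second_order_combination\<close> leave no choice of \<open>M\<close>.
\<close>

definition equivalent_method ::
    "'a::euclidean_space itself \<Rightarrow> real \<Rightarrow> real \<Rightarrow> real \<Rightarrow> real \<Rightarrow> two_step_method \<Rightarrow> bool" where
  "equivalent_method T k a b c M \<longleftrightarrow>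
     (\<forall>(f :: real \<Rightarrow> 'a \<Rightarrow> 'a) t ym y yp.
        filtered_step k a b c f t ym y yp \<longleftrightarrow> one_leg_step M k f t ym y yp)"

definition consistent_combination ::
    "'a::euclidean_space itself \<Rightarrow> real \<Rightarrow> real \<Rightarrow> real \<Rightarrow> real \<Rightarrow> bool" where
  "consistent_combination T k a b c \<longleftrightarrow>
     (\<exists>M. equivalent_method T k a b c M \<and> consistent_method M)"

definition second_order_combination ::
    "'a::euclidean_space itself \<Rightarrow> real \<Rightarrow> real \<Rightarrow> real \<Rightarrow> real \<Rightarrow> bool" where
  "second_order_combination T k a b c \<longleftrightarrow>
     (\<exists>M. equivalent_method T k a b c M \<and> second_order_method M)"

lemma filtered_step_iff_one_leg_step:
  fixes f :: "real \<Rightarrow> 'a::real_normed_vector \<Rightarrow> 'a"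
  assumes "k > 0" "a \<noteq> -1"
  shows "filtered_step k a b c f t ym y yp \<longleftrightarrow>
    one_leg_step \<lparr>alpha2 = 1 / (1 + a), alpha1 = - b / (1 + a) - 1, alpha0 = - c / (1 + a),
                  beta2 = 1 / (1 + a), beta1 = - b / (1 + a), beta0 = - c / (1 + a)\<rparr>
      k f t ym y yp"
proof -
  have a: "1 + a \<noteq> 0" using assms by auto
  let ?z = "(1 / (1 + a)) *\<^sub>R yp + (- b / (1 + a)) *\<^sub>R y + (- c / (1 + a)) *\<^sub>R ym"
  have z: "?z = (1 / (1 + a)) *\<^sub>R (yp - b *\<^sub>R y - c *\<^sub>R ym)"
    by (simp add: scaleR_diff_right)
  have fil: "yp = time_filter a b c ys y ym \<longleftrightarrow> ys = ?z" for ys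
  proof -
    have "yp = time_filter a b c ys y ym \<longleftrightarrow> (1 + a) *\<^sub>R ys = yp - b *\<^sub>R y - c *\<^sub>R ym"
      by (auto simp: time_filter_def algebra_simps)
    also have "\<dots> \<longleftrightarrow> ys = ?z"
      unfolding z using a eq_vector_fraction_iff[of ys 1 "1 + a"] by simp
    finally show ?thesis .
  qed
  have "filtered_step k a b c f t ym y yp \<longleftrightarrow> (?z - y) /\<^sub>R k = f (t + k) ?z"
    by (simp add: filtered_step_def fil backward_euler_step_def)
  also have "\<dots> \<longleftrightarrow> ?z - y = k *\<^sub>R f (t + k) ?z"
  proof -
    have "u /\<^sub>R k = v \<longleftrightarrow> u = k *\<^sub>R v" for u v :: 'a using assms(1) by auto
    then show ?thesis .
  qed
  finally show ?thesis
    by (simp add: one_leg_step_def algebra_simps)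
qed

lemma equivalent_method_iff:
  assumes "k > 0" "a \<noteq> -1"
  shows "equivalent_method TYPE('a::euclidean_space) k a b c M \<longleftrightarrow>
    M = \<lparr>alpha2 = 1 / (1 + a), alpha1 = - b / (1 + a) - 1, alpha0 = - c / (1 + a),
         beta2 = 1 / (1 + a), beta1 = - b / (1 + a), beta0 = - c / (1 + a)\<rparr>"
    (is "_ \<longleftrightarrow> M = ?N")
proof
  assume "M = ?N"
  then show "equivalent_method TYPE('a) k a b c M"
    unfolding equivalent_method_def by (simp only: filtered_step_iff_one_leg_step[OF assms] simp_thms)
next
  assume "equivalent_method TYPE('a) k a b c M"
  then have eq: "one_leg_step M k f t ym y yp \<longleftrightarrow> one_leg_step ?N k f t ym y yp"
    for f :: "real \<Rightarrow> 'a \<Rightarrow> 'a" and t ym y yp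
    using filtered_step_iff_one_leg_step[OF assms, of b c f t ym y yp]
    by (simp add: equivalent_method_def)
  define A where "A M yp y ym = alpha2 M *\<^sub>R yp + alpha1 M *\<^sub>R y + alpha0 M *\<^sub>R ym"
    for M :: two_step_method and yp y ym :: 'a
  define B where "B M yp y ym = beta2 M *\<^sub>R yp + beta1 M *\<^sub>R y + beta0 M *\<^sub>R ym"
    for M :: two_step_method and yp y ym :: 'a
  have step: "one_leg_step M k f t ym y yp \<longleftrightarrow> A M yp y ym = k *\<^sub>R f (t + k) (B M yp y ym)"
    for M f t ym y yp by (simp add: one_leg_step_def A_def B_def)
  obtain e :: 'a where e: "e \<noteq> 0" by (metis nonzero_Basis SOME_Basis)
  have A: "A M yp y ym = A ?N yp y ym" for yp y ym
    using eq[of "\<lambda>_ _. A ?N yp y ym /\<^sub>R k" 0 ym y yp] assms(1) unfolding step by simp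
  have B: "B M yp y ym = B ?N yp y ym" for yp y ym
  proof (rule ccontr)
    assume "B M yp y ym \<noteq> B ?N yp y ym"
    then show False
      using eq[of "\<lambda>_ x. if x = B ?N yp y ym then A ?N yp y ym /\<^sub>R k else A ?N yp y ym /\<^sub>R k + e"
          0 ym y yp] assms(1) e A[of yp y ym]
      unfolding step by (simp add: algebra_simps)
  qed
  have "alpha2 M = alpha2 ?N" "alpha1 M = alpha1 ?N" "alpha0 M = alpha0 ?N"
    using A[of e 0 0] A[of 0 e 0] A[of 0 0 e] e unfolding A_def by (simp_all flip: scaleR_minus_left)
  moreover have "beta2 M = beta2 ?N" "beta1 M = beta1 ?N" "beta0 M = beta0 ?N"
    using B[of e 0 0] B[of 0 e 0] B[of 0 0 e] e unfolding B_def by (simp_all flip: scaleR_minus_left)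
  ultimately show "M = ?N" by simp
qed

definition local_truncation_error ::
    "two_step_method \<Rightarrow> (real \<Rightarrow> 'a::real_normed_vector) \<Rightarrow> real \<Rightarrow> real \<Rightarrow> 'a" where
  "local_truncation_error M y t k =
     alpha2 M *\<^sub>R y (t + k) + alpha1 M *\<^sub>R y t + alpha0 M *\<^sub>R y (t - k)
     - k *\<^sub>R (beta2 M *\<^sub>R vector_derivative y (at (t + k)) + beta1 M *\<^sub>R vector_derivative y (at t)
            + beta0 M *\<^sub>R vector_derivative y (at (t - k)))"

lemma remainder_bound_integrate:
  fixes g :: "real \<Rightarrow> 'a::real_normed_vector"
  assumes g: "\<And>s. (g has_vector_derivative g' s) (at s)" and "g 0 = 0" "C \<ge> 0"
    and bd: "\<And>s. \<bar>s\<bar> \<le> d \<Longrightarrow> norm (g' s) \<le> C * \<bar>s\<bar> ^ n" and s: "\<bar>s\<bar> \<le> d"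
  shows "norm (g s) \<le> C * \<bar>s\<bar> ^ Suc n"
proof -
  have "norm (g s - g 0) \<le> (C * \<bar>s\<bar> ^ n) * norm (s - 0)"
  proof (rule differentiable_bound[where S = "closed_segment 0 s" and f' = "\<lambda>x h. h *\<^sub>R g' x"])
    fix x assume x: "x \<in> closed_segment 0 s"
    show "(g has_derivative (\<lambda>h. h *\<^sub>R g' x)) (at x within closed_segment 0 s)"
      using g[of x] by (simp add: has_vector_derivative_def has_derivative_at_withinI)
    have xs: "\<bar>x\<bar> \<le> \<bar>s\<bar>" using segment_bound1[OF x] by simp
    have "norm (g' x) \<le> C * \<bar>x\<bar> ^ n" using bd xs s by auto
    also have "\<dots> \<le> C * \<bar>s\<bar> ^ n" using xs \<open>C \<ge> 0\<close> by (intro mult_left_mono power_mono) auto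
    finally have "norm (g' x) \<le> C * \<bar>s\<bar> ^ n" .
    then show "onorm (\<lambda>h. h *\<^sub>R g' x) \<le> C * \<bar>s\<bar> ^ n"
      by (intro onorm_le) (metis mult.commute mult_left_mono norm_ge_zero norm_scaleR real_norm_def)
  qed auto
  then show ?thesis using \<open>g 0 = 0\<close> by (simp add: algebra_simps)
qed

lemma local_truncation_error_expansion:
  fixes y :: "real \<Rightarrow> 'a::real_normed_vector"
  assumes y1: "\<And>s. (y has_vector_derivative y' s) (at s)"
    and y2: "\<And>s. (y' has_vector_derivative y'' s) (at s)"
    and y3: "\<And>s. (y'' has_vector_derivative y''' s) (at s)"
    and cont: "isCont y''' t"
  shows "(\<lambda>k. norm (local_truncation_error M y t k
            - (lte_coeff0 M *\<^sub>R y t + (k * lte_coeff1 M) *\<^sub>R y' t + (k\<^sup>2 * lte_coeff2 M) *\<^sub>R y'' t)))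
          \<in> O[at_right 0](\<lambda>k. k ^ 3)"
proof -
  obtain d where d: "d > 0" "\<And>x. dist x t < d \<Longrightarrow> dist (y''' x) (y''' t) < 1"
    using cont unfolding continuous_at_eps_delta by (metis zero_less_one)
  define C where "C = norm (y''' t) + 1"
  have C: "C \<ge> 0" by (simp add: C_def)
  have sh: "((\<lambda>s. h (t + s)) has_vector_derivative h' (t + s)) (at s)"
    if "\<And>s. (h has_vector_derivative h' s) (at s)" for h h' :: "real \<Rightarrow> 'a" and s
  proof -
    have 1: "((\<lambda>s. t + s) has_vector_derivative 1) (at s)"
      by (auto intro!: derivative_eq_intros)
    show ?thesis
      using vector_diff_chain_at[OF 1 that[of "t + s"]] by (simp add: o_def)
  qed
  define r2 where "r2 s = y'' (t + s) - y'' t" for s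
  define r1 where "r1 s = y' (t + s) - y' t - s *\<^sub>R y'' t" for s
  define r0 where "r0 s = y (t + s) - y t - s *\<^sub>R y' t - (s\<^sup>2 / 2) *\<^sub>R y'' t" for s
  have b3: "norm (y''' (t + s)) \<le> C * \<bar>s\<bar> ^ 0" if "\<bar>s\<bar> \<le> d / 2" for s
  proof -
    have "norm (y''' (t + s) - y''' t) < 1" using d that by (simp add: dist_norm)
    then show ?thesis
      using norm_triangle_ineq2[of "y''' (t + s)" "y''' t"] by (simp add: C_def)
  qed
  have D2: "(r2 has_vector_derivative y''' (t + s)) (at s)" for s
    unfolding r2_def by (auto intro!: derivative_eq_intros sh y3)
  have D1: "(r1 has_vector_derivative r2 s) (at s)" for s
    unfolding r1_def r2_def by (auto intro!: derivative_eq_intros sh y2)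
  have D0: "(r0 has_vector_derivative r1 s) (at s)" for s
    unfolding r0_def r1_def
    by (auto intro!: derivative_eq_intros sh y1 simp: has_real_derivative_iff_has_vector_derivative[symmetric])
  have b2: "norm (r2 s) \<le> C * \<bar>s\<bar> ^ 1" if "\<bar>s\<bar> \<le> d / 2" for s
    using remainder_bound_integrate[OF D2 _ C b3 that] by (simp add: r2_def)
  have b1: "norm (r1 s) \<le> C * \<bar>s\<bar> ^ 2" if "\<bar>s\<bar> \<le> d / 2" for s
    using remainder_bound_integrate[OF D1 _ C b2 that] by (simp add: r1_def power2_eq_square)
  have b0: "norm (r0 s) \<le> C * \<bar>s\<bar> ^ 3" if "\<bar>s\<bar> \<le> d / 2" for s
    using remainder_bound_integrate[OF D0 _ C b1 that] by (simp add: r0_def numeral_3_eq_3 power2_eq_square)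
  let ?E = "\<lambda>k. local_truncation_error M y t k
     - (lte_coeff0 M *\<^sub>R y t + (k * lte_coeff1 M) *\<^sub>R y' t + (k\<^sup>2 * lte_coeff2 M) *\<^sub>R y'' t)"
  have vd: "vector_derivative y (at s) = y' s" for s using y1 by (rule vector_derivative_at)
  have E: "?E k = alpha2 M *\<^sub>R r0 k + alpha0 M *\<^sub>R r0 (- k)
      - (k * beta2 M) *\<^sub>R r1 k - (k * beta0 M) *\<^sub>R r1 (- k)" for k
  proof -
    have e1: "y (t + k) = r0 k + y t + k *\<^sub>R y' t + (k\<^sup>2 / 2) *\<^sub>R y'' t"
      and e2: "y (t - k) = r0 (- k) + y t - k *\<^sub>R y' t + (k\<^sup>2 / 2) *\<^sub>R y'' t"
      and e3: "y' (t + k) = r1 k + y' t + k *\<^sub>R y'' t"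
      and e4: "y' (t - k) = r1 (- k) + y' t - k *\<^sub>R y'' t"
      by (simp_all add: r0_def r1_def)
    show ?thesis
      unfolding local_truncation_error_def vd e1 e2 e3 e4 lte_coeff0_def lte_coeff1_def lte_coeff2_def
      by (simp add: algebra_simps power2_eq_square)
  qed
  let ?K = "(\<bar>alpha2 M\<bar> + \<bar>alpha0 M\<bar> + \<bar>beta2 M\<bar> + \<bar>beta0 M\<bar>) * C"
  have "norm (norm (?E k)) \<le> ?K * norm (k ^ 3)" if k: "0 < k" "k < d / 2" for k
  proof -
    have "norm (?E k) \<le> \<bar>alpha2 M\<bar> * norm (r0 k) + \<bar>alpha0 M\<bar> * norm (r0 (- k))
        + \<bar>k * beta2 M\<bar> * norm (r1 k) + \<bar>k * beta0 M\<bar> * norm (r1 (- k))"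
      unfolding E norm_scaleR[symmetric]
      by (intro norm_triangle_le_diff norm_triangle_le add_mono order_refl)
    also have "\<dots> \<le> \<bar>alpha2 M\<bar> * (C * k ^ 3) + \<bar>alpha0 M\<bar> * (C * k ^ 3)
        + \<bar>k * beta2 M\<bar> * (C * k ^ 2) + \<bar>k * beta0 M\<bar> * (C * k ^ 2)"
      using b0[of k] b0[of "- k"] b1[of k] b1[of "- k"] k
      by (intro add_mono mult_left_mono) auto
    also have "\<dots> = ?K * k ^ 3"
      using k by (simp add: abs_mult algebra_simps power2_eq_square power3_eq_cube)
    finally show ?thesis using k by simp
  qed
  moreover have "eventually (\<lambda>k. 0 < k \<and> k < d / 2) (at_right 0)"
    using d eventually_at_right_less[of "0::real"] eventually_at_right_real[of 0 "d / 2"]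
    by (auto elim!: eventually_mono)
  ultimately show ?thesis
    by (intro bigoI[where c = ?K]) (auto elim!: eventually_mono)
qed

end

theory Submission
  imports Defs
begin

text \<open>
  For \<open>a \<noteq> -1\<close> the filter can be solved for the pre-filtered value, so the combination is one fixed
  one-leg method, and no other coefficients give the same step relation for all \<open>f\<close>
  (\<open>equivalent_method_iff\<close>). Consistency and second order of the combination are therefore
  equations between \<open>a\<close>, \<open>b\<close>, \<open>c\<close>: up to the nonzero factor \<open>1 / (1 + a)\<close>, the three coefficients of
  the truncation error are \<open>-(a + b + c)\<close>, \<open>b + 2c\<close> and \<open>-(1 + 3c) / 2\<close>. The first two vanish exactly
  when \<open>(a, b, c)\<close> is a multiple of the second difference \<open>(1, -2, 1)\<close>; writing the multiple as
  \<open>-\<nu>/2\<close>, the condition \<open>a \<noteq> -1\<close> becomes \<open>\<nu> \<noteq> 2\<close>. The third then vanishes exactly for \<open>c = -1/3\<close>,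
  that is \<open>\<nu> = 2/3\<close>.
\<close>

definition filtered_euler_method :: "real \<Rightarrow> real \<Rightarrow> real \<Rightarrow> two_step_method" where
  "filtered_euler_method a b c =
     \<lparr>alpha2 = 1 / (1 + a), alpha1 = - b / (1 + a) - 1, alpha0 = - c / (1 + a),
      beta2 = 1 / (1 + a), beta1 = - b / (1 + a), beta0 = - c / (1 + a)\<rparr>"

lemma lte_coeffs_filtered_euler_method:
  assumes "a \<noteq> -1"
  shows "lte_coeff0 (filtered_euler_method a b c) = - (a + b + c) / (1 + a)"
    and "lte_coeff1 (filtered_euler_method a b c) = (b + 2 * c) / (1 + a)"
    and "lte_coeff2 (filtered_euler_method a b c) = - (1 + 3 * c) / (2 * (1 + a))"
proof -
  define d where "d = 1 + a"
  have d: "d \<noteq> 0" and a: "a = d - 1" using assms by (auto simp: d_def)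
  show "lte_coeff0 (filtered_euler_method a b c) = - (a + b + c) / (1 + a)"
    and "lte_coeff1 (filtered_euler_method a b c) = (b + 2 * c) / (1 + a)"
    and "lte_coeff2 (filtered_euler_method a b c) = - (1 + 3 * c) / (2 * (1 + a))"
    using d by (simp_all add: a lte_coeff0_def lte_coeff1_def lte_coeff2_def
        filtered_euler_method_def field_simps)
qed

lemma consistent_filtered_euler_method_iff:
  assumes "a \<noteq> -1"
  shows "consistent_method (filtered_euler_method a b c) \<longleftrightarrow> a = c \<and> b = - 2 * c"
proof -
  have "1 + a \<noteq> 0" using assms by auto
  then show ?thesis
    by (auto simp: consistent_method_def lte_coeffs_filtered_euler_method[OF assms])
qed

lemma second_order_filtered_euler_method_iff:
  assumes "a \<noteq> -1"
  shows "second_order_method (filtered_euler_method a b c) \<longleftrightarrow> a = c \<and> b = - 2 * c \<and> c = - 1 / 3"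
proof -
  have "1 + a \<noteq> 0" using assms by auto
  then show ?thesis
    by (auto simp: second_order_method_def consistent_filtered_euler_method_iff[OF assms]
          lte_coeffs_filtered_euler_method[OF assms])
qed

lemma filtered_euler_method_second_difference:
  assumes "\<nu> \<noteq> 2"
  shows "filtered_euler_method (- \<nu> / 2) \<nu> (- \<nu> / 2) =
    \<lparr>alpha2 = 1 / (1 - \<nu> / 2), alpha1 = - ((1 + \<nu> / 2) / (1 - \<nu> / 2)),
     alpha0 = (\<nu> / 2) / (1 - \<nu> / 2),
     beta2 = 1 / (1 - \<nu> / 2), beta1 = - (\<nu> / (1 - \<nu> / 2)), beta0 = (\<nu> / 2) / (1 - \<nu> / 2)\<rparr>"
proof -
  have "1 - \<nu> / 2 \<noteq> 0" using assms by auto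
  then have "- \<nu> / (1 - \<nu> / 2) - 1 = - ((1 + \<nu> / 2) / (1 - \<nu> / 2))"
    by (simp add: field_simps)
  then show ?thesis
    by (simp add: filtered_euler_method_def)
qed

theorem proposition2p1:
  fixes k a b c :: real
  assumes "k > 0" and "a \<noteq> -1"
  shows "(consistent_combination TYPE('a::euclidean_space) k a b c \<longleftrightarrow>
            (\<exists>\<nu>. \<nu> \<noteq> 2 \<and> a = - \<nu> / 2 \<and> c = - \<nu> / 2 \<and> b = \<nu>))
       \<and> (\<forall>\<nu>. \<nu> \<noteq> 2 \<and> a = - \<nu> / 2 \<and> c = - \<nu> / 2 \<and> b = \<nu> \<longrightarrow>
            (\<forall>ys y ym :: 'a. time_filter a b c ys y ym = ys - (\<nu> / 2) *\<^sub>R (ys - 2 *\<^sub>R y + ym))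
          \<and> (\<forall>(f :: real \<Rightarrow> 'a \<Rightarrow> 'a) t ym y yp.
               filtered_step k a b c f t ym y yp \<longleftrightarrow>
               (1 / (1 - \<nu> / 2)) *\<^sub>R yp - ((1 + \<nu> / 2) / (1 - \<nu> / 2)) *\<^sub>R y
                 + ((\<nu> / 2) / (1 - \<nu> / 2)) *\<^sub>R ym
               = k *\<^sub>R f (t + k) ((1 / (1 - \<nu> / 2)) *\<^sub>R yp - (\<nu> / (1 - \<nu> / 2)) *\<^sub>R y
                                + ((\<nu> / 2) / (1 - \<nu> / 2)) *\<^sub>R ym))
          \<and> (\<forall>M. equivalent_method TYPE('a) k a b c M \<longleftrightarrow>
               M = \<lparr>alpha2 = 1 / (1 - \<nu> / 2),
                    alpha1 = - ((1 + \<nu> / 2) / (1 - \<nu> / 2)),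
                    alpha0 = (\<nu> / 2) / (1 - \<nu> / 2),
                    beta2 = 1 / (1 - \<nu> / 2),
                    beta1 = - (\<nu> / (1 - \<nu> / 2)),
                    beta0 = (\<nu> / 2) / (1 - \<nu> / 2)\<rparr>)
          \<and> (second_order_combination TYPE('a) k a b c \<longleftrightarrow> \<nu> = 2 / 3))"
proof -
  let ?T = "TYPE('a)"
  have equiv: "equivalent_method ?T k a b c M \<longleftrightarrow> M = filtered_euler_method a b c" for M
    unfolding filtered_euler_method_def by (rule equivalent_method_iff[OF assms])
  have cons: "consistent_combination ?T k a b c \<longleftrightarrow>
      (\<exists>\<nu>. \<nu> \<noteq> 2 \<and> a = - \<nu> / 2 \<and> c = - \<nu> / 2 \<and> b = \<nu>)"
  proof -
    have "consistent_combination ?T k a b c \<longleftrightarrow> a = c \<and> b = - 2 * c"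
      by (simp add: consistent_combination_def equiv
            consistent_filtered_euler_method_iff[OF assms(2)])
    also have "\<dots> \<longleftrightarrow> (\<exists>\<nu>. \<nu> \<noteq> 2 \<and> a = - \<nu> / 2 \<and> c = - \<nu> / 2 \<and> b = \<nu>)"
      using assms(2) by auto
    finally show ?thesis .
  qed
  have order: "second_order_combination ?T k a b c \<longleftrightarrow> \<nu> = 2 / 3"
    if "a = - \<nu> / 2" "c = - \<nu> / 2" "b = \<nu>" for \<nu>
  proof -
    have "second_order_combination ?T k a b c \<longleftrightarrow> a = c \<and> b = - 2 * c \<and> c = - 1 / 3"
      by (simp add: second_order_combination_def equiv
            second_order_filtered_euler_method_iff[OF assms(2)])
    also have "\<dots> \<longleftrightarrow> \<nu> = 2 / 3"
      using that by auto
    finally show ?thesis .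
  qed
  have filt: "time_filter a b c ys y ym = ys - (\<nu> / 2) *\<^sub>R (ys - 2 *\<^sub>R y + ym)"
    if "a = - \<nu> / 2" "c = - \<nu> / 2" "b = \<nu>" for \<nu> and ys y ym :: 'a
    using that by (simp add: time_filter_def algebra_simps)
  show ?thesis
  proof (intro conjI[OF cons] allI impI)
    fix \<nu> assume \<nu>: "\<nu> \<noteq> 2 \<and> a = - \<nu> / 2 \<and> c = - \<nu> / 2 \<and> b = \<nu>"
    define N where "N = \<lparr>alpha2 = 1 / (1 - \<nu> / 2), alpha1 = - ((1 + \<nu> / 2) / (1 - \<nu> / 2)),
      alpha0 = (\<nu> / 2) / (1 - \<nu> / 2),
      beta2 = 1 / (1 - \<nu> / 2), beta1 = - (\<nu> / (1 - \<nu> / 2)), beta0 = (\<nu> / 2) / (1 - \<nu> / 2)\<rparr>"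
    have "filtered_euler_method a b c = N"
      using \<nu> filtered_euler_method_second_difference[of \<nu>] unfolding N_def by metis
    then have equiv_N: "equivalent_method ?T k a b c M \<longleftrightarrow> M = N" for M
      by (simp only: equiv)
    have step: "filtered_step k a b c f t ym y yp \<longleftrightarrow>
        (1 / (1 - \<nu> / 2)) *\<^sub>R yp - ((1 + \<nu> / 2) / (1 - \<nu> / 2)) *\<^sub>R y
          + ((\<nu> / 2) / (1 - \<nu> / 2)) *\<^sub>R ym
        = k *\<^sub>R f (t + k) ((1 / (1 - \<nu> / 2)) *\<^sub>R yp - (\<nu> / (1 - \<nu> / 2)) *\<^sub>R y
                         + ((\<nu> / 2) / (1 - \<nu> / 2)) *\<^sub>R ym)"
      for f :: "real \<Rightarrow> 'a \<Rightarrow> 'a" and t ym y yp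
    proof -
      have "filtered_step k a b c f t ym y yp \<longleftrightarrow> one_leg_step N k f t ym y yp"
        using equiv_N[of N] by (simp add: equivalent_method_def)
      then show ?thesis
        unfolding one_leg_step_def N_def two_step_method.simps
        by (simp only: scaleR_minus_left add_uminus_conv_diff)
    qed
    show "(\<forall>ys y ym :: 'a. time_filter a b c ys y ym = ys - (\<nu> / 2) *\<^sub>R (ys - 2 *\<^sub>R y + ym))
          \<and> (\<forall>(f :: real \<Rightarrow> 'a \<Rightarrow> 'a) t ym y yp.
               filtered_step k a b c f t ym y yp \<longleftrightarrow>
               (1 / (1 - \<nu> / 2)) *\<^sub>R yp - ((1 + \<nu> / 2) / (1 - \<nu> / 2)) *\<^sub>R y
                 + ((\<nu> / 2) / (1 - \<nu> / 2)) *\<^sub>R ym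
               = k *\<^sub>R f (t + k) ((1 / (1 - \<nu> / 2)) *\<^sub>R yp - (\<nu> / (1 - \<nu> / 2)) *\<^sub>R y
                                + ((\<nu> / 2) / (1 - \<nu> / 2)) *\<^sub>R ym))
          \<and> (\<forall>M. equivalent_method TYPE('a) k a b c M \<longleftrightarrow>
               M = \<lparr>alpha2 = 1 / (1 - \<nu> / 2),
                    alpha1 = - ((1 + \<nu> / 2) / (1 - \<nu> / 2)),
                    alpha0 = (\<nu> / 2) / (1 - \<nu> / 2),
                    beta2 = 1 / (1 - \<nu> / 2),
                    beta1 = - (\<nu> / (1 - \<nu> / 2)),
                    beta0 = (\<nu> / 2) / (1 - \<nu> / 2)\<rparr>)
          \<and> (second_order_combination TYPE('a) k a b c \<longleftrightarrow> \<nu> = 2 / 3)"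
      using filt order step equiv_N \<nu> unfolding N_def by blast
  qed
qed

end
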